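(* Let $n,m\in\mathbb{N}$ and $\alpha\in(0,1]$. Suppose that $\Sigma_{\text{pk}}\subset\Sigma_{\text{stab}}(\alpha)$ is compact. Let $q\in\mathbb{N}$ and let $K_i\in\mathbb{R}^{m\times n}$ and symmetric $P_i\in\mathbb{R}^{n\times n}$ with $P_i\ge I$, $i\in\{1,\ldots,q\}$, be such that every $(A,B)\in\Sigma_{\text{pk}}$ satisfies $$\alpha^2P_i-(A+BK_i)^\top P_i(A+BK_i)\ge I$$ for some $i\in\{1,\ldots,q\}$. Write $z=\begin{bmatrix}z_1&z_2\end{bmatrix}^\top\in\mathbb{R}^2$, define $\phi:\mathbb{R}^n\times\mathbb{R}^2\to\{1,\ldots,q\}$ by $$\phi(x,z)=\begin{cases}z_2&\text{if }z_2\in\{1,\ldots,q\}\text{ and }x^\top P_{z_2}x\le z_1,\\(z_2\bmod q)+1&\text{if }z_2\in\{1,\ldots,q\}\text{ and }x^\top P_{z_2}x>z_1,\\1&\text{otherwise,}\end{cases}$$ and define $f:\mathbb{R}^n\times\mathbb{R}^2\to\mathbb{R}^2$ and $g:\mathbb{R}^n\times\mathbb{R}^2\to\mathbb{R}^m$ by $$f(x,z)=\begin{bmatrix}\alpha^2x^\top P_{\phi(x,z)}x-\|x\|^2\\ \phi(x,z)\end{bmatrix},\qquad g(x,z)=K_{\phi(x,z)}x.$$ For $(A,B)\in\Sigma_{\text{pk}}$, let $x(t,x_0,z_0)$, $z(t,x_0,z_0)$ denote the solution of the closed-loop system $$x(t+1)=Ax(t)+Bg(x(t),z(t)),\qquad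 z(t+1)=f(x(t),z(t)),\qquad x(0)=x_0,\ z(0)=z_0.$$ Then both of the following hold: (1) For every $x_0\in\mathbb{R}^n$, $z_0\in\mathbb{R}^2$ and $(A,B)\in\Sigma_{\text{pk}}$, $z(t,x_0,z_0)$ is bounded (over $t\in\mathbb{Z}_+$). (2) There exist $c\ge1$ and $\eta\in[0,\alpha)$ such that for every $(A,B)\in\Sigma_{\text{pk}}$, $x_0\in\mathbb{R}^n$ and $z_0\in\mathbb{R}^2$, we have $\|x(t,x_0,z_0)\|\le c\,\eta^t\|x_0\|$ for all $t\in\mathbb{Z}_+$.
   Context: $\mathbb{Z}_+$ is the set of nonnegative integers, $\mathbb{N}$ the positive integers. For symmetric matrices, $M\ge N$ means $M-N$ is positive semi-definite. $\Sigma_{\text{stab}}(\alpha)$ is the set of pairs $(A,B)\in\mathbb{R}^{n\times n}\times\mathbb{R}^{n\times m}$ that are $\alpha$-stabilizable, i.e., for which there exists $K\in\mathbb{R}^{m\times n}$ such that every eigenvalue $\lambda$ of $A+BK$ satisfies $|\lambda|<\alpha$. Vector norms are Euclidean. *)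

theory Defs
  imports "HOL-Analysis.Analysis"
begin

text \<open>The dimensions n and m are the cardinalities of the index types \<open>'n\<close> and \<open>'m\<close>.\<close>

definition pos_semidef :: "real^'n^'n \<Rightarrow> bool" where
  "pos_semidef M \<longleftrightarrow> transpose M = M \<and> (\<forall>x. 0 \<le> x \<bullet> (M *v x))"

definition loewner_le :: "real^'n^'n \<Rightarrow> real^'n^'n \<Rightarrow> bool" where
  "loewner_le N M \<longleftrightarrow> pos_semidef (M - N)"

text \<open>Eigenvalues of a real matrix are taken over the complex numbers.\<close>

definition complex_eigenvalue :: "real^'n^'n \<Rightarrow> complex \<Rightarrow> bool" where
  "complex_eigenvalue M l \<longleftrightarrow>
     (\<exists>v :: complex^'n. v \<noteq> 0 \<and> map_matrix complex_of_real M *v v = l *s v)"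

definition Sigma_stab :: "real \<Rightarrow> ((real^'n^'n) \<times> (real^'m^'n)) set" where
  "Sigma_stab \<alpha> =
     {(A, B). \<exists>K :: real^'n^'m. \<forall>l. complex_eigenvalue (A + B ** K) l \<longrightarrow> cmod l < \<alpha>}"

text \<open>
  The controller families are functions on the naturals of which only the values at
  1, ..., q matter. The second component of z is an arbitrary real; the floor below is
  only taken when it is one of the numbers 1, ..., q.
\<close>

definition switch_index :: "nat \<Rightarrow> (nat \<Rightarrow> real^'n^'n) \<Rightarrow> real^'n \<Rightarrow> real^2 \<Rightarrow> nat" where
  "switch_index q P x z =
     (if z $ 2 \<in> real ` {1..q} then
        (let i = nat \<lfloor>z $ 2\<rfloor> in
           if x \<bullet> (P i *v x) \<le> z $ 1 then i else i mod q + 1)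
      else 1)"

definition switch_update ::
  "real \<Rightarrow> nat \<Rightarrow> (nat \<Rightarrow> real^'n^'n) \<Rightarrow> real^'n \<Rightarrow> real^2 \<Rightarrow> real^2" where
  "switch_update \<alpha> q P x z =
     (let i = switch_index q P x z in
        vector [\<alpha>\<^sup>2 * (x \<bullet> (P i *v x)) - (norm x)\<^sup>2, real i])"

definition switch_input ::
  "nat \<Rightarrow> (nat \<Rightarrow> real^'n^'n) \<Rightarrow> (nat \<Rightarrow> real^'n^'m) \<Rightarrow> real^'n \<Rightarrow> real^2 \<Rightarrow> real^'m" where
  "switch_input q P K x z = K (switch_index q P x z) *v x"

primrec closed_loop ::
  "real^'n^'n \<Rightarrow> real^'m^'n \<Rightarrow> (real^'n \<Rightarrow> real^2 \<Rightarrow> real^2) \<Rightarrow> (real^'n \<Rightarrow> real^2 \<Rightarrow> real^'m)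
    \<Rightarrow> real^'n \<Rightarrow> real^2 \<Rightarrow> nat \<Rightarrow> (real^'n) \<times> (real^2)" where
  "closed_loop A B f g x0 z0 0 = (x0, z0)"
| "closed_loop A B f g x0 z0 (Suc t) =
     (case closed_loop A B f g x0 z0 t of (x, z) \<Rightarrow> (A *v x + B *v g x z, f x z))"

definition state_traj where
  "state_traj A B f g x0 z0 t = fst (closed_loop A B f g x0 z0 t)"

definition ctrl_traj where
  "ctrl_traj A B f g x0 z0 t = snd (closed_loop A B f g x0 z0 t)"

end

theory Submission
  imports Defs
begin

text \<open>
  Let \<open>V\<^sub>i x = x \<bullet> P i *v x\<close>, and let \<open>i\<close> be the active index. As long as the index is kept,
  \<open>V\<^sub>i\<close> contracts by the factor \<open>\<eta>\<^sup>2 = \<alpha>\<^sup>2 - 1 / p\<close>, where \<open>p\<close> bounds all \<open>V\<^sub>i\<close> on the unit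
  sphere. An index that satisfies the Lyapunov inequality of the true system is never abandoned,
  so every switch decreases the cyclic distance \<open>d\<close> of the active index to such an index. By
  compactness a switch increases the active Lyapunov function at most by a uniform factor
  \<open>\<eta>\<^sup>2 * C\<close>. Hence \<open>V\<^sub>i x * C ^ d\<close> contracts by \<open>\<eta>\<^sup>2\<close> in every step.
\<close>

section \<open>Matrix norms and quadratic forms\<close>

text \<open>The norm of a matrix is here the Euclidean norm of its entries (Frobenius norm), so
  Cauchy-Schwarz in each row suffices.\<close>

lemma norm_matrix_vector_mult_le:
  fixes A :: "real^'n^'m" and x :: "real^'n"
  shows "norm (A *v x) \<le> norm A * norm x"
proof -
  have "norm (A *v x) \<le> L2_set (\<lambda>i. norm x * norm (A $ i)) UNIV"
    unfolding norm_vec_def[of "A *v x"]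
  proof (rule L2_set_mono)
    show "norm ((A *v x) $ i) \<le> norm x * norm (A $ i)" for i
      using Cauchy_Schwarz_ineq2[of "A $ i" x]
      by (simp add: matrix_vector_mul_component mult.commute)
  qed simp
  also have "\<dots> = norm x * norm A"
    by (simp add: norm_vec_def[of A] L2_set_right_distrib)
  finally show ?thesis
    by (simp add: mult.commute)
qed

lemma quadratic_form_le:
  fixes A :: "real^'n^'n"
  shows "x \<bullet> (A *v x) \<le> norm A * (norm x)\<^sup>2"
proof -
  have "x \<bullet> (A *v x) \<le> norm x * norm (A *v x)"
    by (rule norm_cauchy_schwarz)
  also have "\<dots> \<le> norm x * (norm A * norm x)"
    by (intro mult_left_mono norm_matrix_vector_mult_le norm_ge_zero)
  finally show ?thesis
    by (simp add: power2_eq_square mult_ac)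
qed

lemma loewner_leD: "loewner_le N M \<Longrightarrow> x \<bullet> (N *v x) \<le> x \<bullet> (M *v x)"
  by (auto simp: loewner_le_def pos_semidef_def matrix_vector_mult_diff_rdistrib inner_diff_right
      dest: spec[of _ x])

text \<open>For \<open>c = \<alpha>\<^sup>2\<close> and \<open>F\<close> the closed-loop matrix of
  an index, the right-hand side is the threshold that \<open>switch_update\<close> stores; such an
  index therefore passes the test at the next state.\<close>

lemma lyapunov_decrease:
  fixes F P :: "real^'n^'n"
  assumes "loewner_le (mat 1) (c *\<^sub>R P - transpose F ** P ** F)"
  shows "(F *v x) \<bullet> (P *v (F *v x)) \<le> c * (x \<bullet> (P *v x)) - (norm x)\<^sup>2"
proof -
  have "x \<bullet> ((transpose F ** P ** F) *v x) = (F *v x) \<bullet> (P *v (F *v x))"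
    by (simp add: dot_lmul_matrix[symmetric] matrix_vector_mul_assoc[symmetric]
        flip: transpose_matrix_vector)
  then show ?thesis
    using loewner_leD[OF assms, of x]
    by (simp add: matrix_vector_mult_diff_rdistrib inner_diff_right power2_norm_eq_inner
        scaleR_matrix_vector_assoc[symmetric])
qed

section \<open>Switching index and cyclic distance\<close>

lemma switch_index_mem: "1 \<le> q \<Longrightarrow> switch_index q P x z \<in> {1..q}"
  by (auto simp: switch_index_def Let_def Suc_le_eq)

text \<open>An update always stores a valid index, so the default branch of
  \<open>switch_index\<close> can act only at the initial time.\<close>

lemma switch_index_update:
  fixes P :: "nat \<Rightarrow> real^'n^'n"
  assumes "1 \<le> q"
  defines "i \<equiv> \<lambda>x z. switch_index q P x z"
  shows "i y (switch_update \<alpha> q P x z) =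
    (if y \<bullet> (P (i x z) *v y) \<le> \<alpha>\<^sup>2 * (x \<bullet> (P (i x z) *v x)) - (norm x)\<^sup>2
     then i x z else i x z mod q + 1)"
  using switch_index_mem[OF assms(1), of P x z] unfolding i_def
  by (subst switch_index_def) (simp add: switch_update_def Let_def)

text \<open>For indices in \<open>{1..q}\<close>, this counts the applications of
  \<open>i mod q + 1\<close> that lead from \<open>i\<close> to \<open>j\<close>; the second case
  passes through \<open>q\<close>.\<close>

definition cyclic_dist :: "nat \<Rightarrow> nat \<Rightarrow> nat \<Rightarrow> nat" where
  "cyclic_dist q j i = (if i \<le> j then j - i else j + q - i)"

lemma cyclic_dist_le: "i \<in> {1..q} \<Longrightarrow> j \<in> {1..q} \<Longrightarrow> cyclic_dist q j i \<le> q"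
  by (auto simp: cyclic_dist_def)

lemma cyclic_dist_next:
  assumes "i \<in> {1..q}" "j \<in> {1..q}" "i \<noteq> j"
  shows "cyclic_dist q j i = Suc (cyclic_dist q j (i mod q + 1))"
  \<comment> \<open>At \<open>i = q\<close> the successor is 1 and the distance drops from
    \<open>j\<close> to \<open>j - 1\<close>.\<close>
  using assms by (cases "i = q") (auto simp: cyclic_dist_def)

section \<open>Closed-loop trajectories: decay and boundedness\<close>

lemma state_traj_0 [simp]: "state_traj A B f g x0 z0 0 = x0"
  and ctrl_traj_0 [simp]: "ctrl_traj A B f g x0 z0 0 = z0"
  and state_traj_Suc: "state_traj A B f g x0 z0 (Suc t) =
    A *v state_traj A B f g x0 z0 t + B *v g (state_traj A B f g x0 z0 t) (ctrl_traj A B f g x0 z0 t)"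
  and ctrl_traj_Suc: "ctrl_traj A B f g x0 z0 (Suc t) =
    f (state_traj A B f g x0 z0 t) (ctrl_traj A B f g x0 z0 t)"
  by (simp_all add: state_traj_def ctrl_traj_def split: prod.split)

text \<open>The potential \<open>U\<close> uses the index chosen at the current pair, not the one
  stored in \<open>z\<close>, so the step also covers an arbitrary initial controller state.\<close>

lemma switched_potential_step:
  fixes P :: "nat \<Rightarrow> real^'n^'n" and K :: "nat \<Rightarrow> real^'n^'m"
  assumes q: "1 \<le> q" and "0 < p" "1 \<le> C" and \<eta>: "\<eta>\<^sup>2 = \<alpha>\<^sup>2 - 1 / p"
    and P_ge: "\<And>i x. i \<in> {1..q} \<Longrightarrow> (norm x)\<^sup>2 \<le> x \<bullet> (P i *v x)"
    and P_le: "\<And>i x. i \<in> {1..q} \<Longrightarrow> x \<bullet> (P i *v x) \<le> p * (norm x)\<^sup>2"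
    and M: "\<And>i x. i \<in> {1..q} \<Longrightarrow> norm ((A + B ** K i) *v x) \<le> M * norm x"
    and C: "p * M\<^sup>2 \<le> \<eta>\<^sup>2 * C"
    and j: "j \<in> {1..q}"
      "loewner_le (mat 1) (\<alpha>\<^sup>2 *\<^sub>R P j - transpose (A + B ** K j) ** P j ** (A + B ** K j))"
  defines "U \<equiv> \<lambda>x z. x \<bullet> (P (switch_index q P x z) *v x) * C ^ cyclic_dist q j (switch_index q P x z)"
  shows "U (A *v x + B *v switch_input q P K x z) (switch_update \<alpha> q P x z) \<le> \<eta>\<^sup>2 * U x z"
proof -
  define i where "i = switch_index q P x z"
  define F where "F = A + B ** K i"
  define y where "y = F *v x"
  define W where "W = x \<bullet> (P i *v x)"
  define i' where "i' = switch_index q P y (switch_update \<alpha> q P x z)"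
  have i: "i \<in> {1..q}" and i'_mem: "i' \<in> {1..q}"
    unfolding i_def i'_def by (rule switch_index_mem[OF q])+
  have y: "A *v x + B *v switch_input q P K x z = y"
    by (simp add: y_def F_def i_def switch_input_def matrix_vector_mult_add_rdistrib
        matrix_vector_mul_assoc)
  have i': "i' = (if y \<bullet> (P i *v y) \<le> \<alpha>\<^sup>2 * W - (norm x)\<^sup>2 then i else i mod q + 1)"
    unfolding i'_def i_def W_def by (rule switch_index_update[OF q])
  have W: "(norm x)\<^sup>2 \<le> W" "W \<le> p * (norm x)\<^sup>2"
    unfolding W_def by (rule P_ge[OF i] P_le[OF i])+
  have "0 \<le> W"
    using W(1) zero_le_power2 by (rule order_trans[rotated])
  have "y \<bullet> (P i' *v y) * C ^ cyclic_dist q j i' \<le> \<eta>\<^sup>2 * (W * C ^ cyclic_dist q j i)"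
  proof (cases "y \<bullet> (P i *v y) \<le> \<alpha>\<^sup>2 * W - (norm x)\<^sup>2")
    case True
    \<comment> \<open>The subtracted \<open>(norm x)\<^sup>2\<close> costs at least
      \<open>W / p\<close>, whence the rate \<open>\<alpha>\<^sup>2 - 1 / p\<close>. The passed test
      alone gives this, even for an index that is wrong for the true system.\<close>
    have "W / p \<le> (norm x)\<^sup>2"
      using W(2) \<open>0 < p\<close> by (simp add: divide_le_eq mult.commute)
    then have "y \<bullet> (P i *v y) \<le> \<eta>\<^sup>2 * W"
      using True by (simp add: \<eta> algebra_simps)
    then have "y \<bullet> (P i *v y) * C ^ cyclic_dist q j i \<le> (\<eta>\<^sup>2 * W) * C ^ cyclic_dist q j i"
      by (rule mult_right_mono) (use \<open>1 \<le> C\<close> in simp)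
    then show ?thesis
      using True i' by (simp add: mult.assoc)
  next
    case False
    \<comment> \<open>At \<open>i = j\<close> the Lyapunov inequality would make the failed test
      succeed.\<close>
    then have "i \<noteq> j"
      using lyapunov_decrease[OF j(2), of x] by (auto simp: y_def F_def W_def)
    have "y \<bullet> (P i' *v y) \<le> p * (norm y)\<^sup>2"
      by (rule P_le[OF i'_mem])
    also have "\<dots> \<le> p * (M * norm x)\<^sup>2"
      using M[OF i, of x] \<open>0 < p\<close> unfolding y_def F_def
      by (intro mult_left_mono power_mono) auto
    also have "\<dots> = (p * M\<^sup>2) * (norm x)\<^sup>2"
      by (simp add: power_mult_distrib)
    also have "\<dots> \<le> (\<eta>\<^sup>2 * C) * W"
      using C W(1) \<open>1 \<le> C\<close>
      by (intro mult_mono[of _ "\<eta>\<^sup>2 * C"]) auto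
    finally have "y \<bullet> (P i' *v y) * C ^ cyclic_dist q j i' \<le> ((\<eta>\<^sup>2 * C) * W) * C ^ cyclic_dist q j i'"
      by (rule mult_right_mono) (use \<open>1 \<le> C\<close> in simp)
    \<comment> \<open>The switch lowers the exponent by one, which absorbs the extra factor
      \<open>C\<close>.\<close>
    also have "\<dots> = \<eta>\<^sup>2 * (W * C ^ cyclic_dist q j i)"
      using False i' by (simp add: cyclic_dist_next[OF i j(1) \<open>i \<noteq> j\<close>])
    finally show ?thesis .
  qed
  then show ?thesis
    unfolding U_def y by (simp add: i'_def[symmetric] i_def[symmetric] W_def)
qed

text \<open>The potential lies between the squared norm of the state and \<open>p * C ^ q\<close>
  times it. The index \<open>j\<close> enters only the potential, so the final constant is the same
  for all systems sharing \<open>p\<close>, \<open>M\<close> and \<open>C\<close>.\<close>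

lemma switched_decay:
  fixes P :: "nat \<Rightarrow> real^'n^'n" and K :: "nat \<Rightarrow> real^'n^'m"
  assumes q: "1 \<le> q" and "0 < p" "1 \<le> C" and "0 \<le> \<eta>" and \<eta>: "\<eta>\<^sup>2 = \<alpha>\<^sup>2 - 1 / p"
    and P_ge: "\<And>i x. i \<in> {1..q} \<Longrightarrow> (norm x)\<^sup>2 \<le> x \<bullet> (P i *v x)"
    and P_le: "\<And>i x. i \<in> {1..q} \<Longrightarrow> x \<bullet> (P i *v x) \<le> p * (norm x)\<^sup>2"
    and M: "\<And>i x. i \<in> {1..q} \<Longrightarrow> norm ((A + B ** K i) *v x) \<le> M * norm x"
    and C: "p * M\<^sup>2 \<le> \<eta>\<^sup>2 * C"
    and j: "j \<in> {1..q}"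
      "loewner_le (mat 1) (\<alpha>\<^sup>2 *\<^sub>R P j - transpose (A + B ** K j) ** P j ** (A + B ** K j))"
  shows "norm (state_traj A B (switch_update \<alpha> q P) (switch_input q P K) x0 z0 t)
    \<le> sqrt (p * C ^ q) * \<eta> ^ t * norm x0"
proof -
  define x where "x = state_traj A B (switch_update \<alpha> q P) (switch_input q P K) x0 z0"
  define z where "z = ctrl_traj A B (switch_update \<alpha> q P) (switch_input q P K) x0 z0"
  define i where "i t = switch_index q P (x t) (z t)" for t
  define U where "U t = x t \<bullet> (P (i t) *v x t) * C ^ cyclic_dist q j (i t)" for t
  have i: "i t \<in> {1..q}" for t
    unfolding i_def by (rule switch_index_mem[OF q])
  have U_Suc: "U (Suc t) \<le> \<eta>\<^sup>2 * U t" for t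
    unfolding U_def i_def x_def z_def state_traj_Suc ctrl_traj_Suc
    by (rule switched_potential_step[where A = A and B = B and K = K and P = P,
            OF q \<open>0 < p\<close> \<open>1 \<le> C\<close> \<eta> P_ge P_le M C j])
  have U_0: "U 0 \<le> p * C ^ q * (norm x0)\<^sup>2"
  proof -
    have "U 0 \<le> (p * (norm (x 0))\<^sup>2) * C ^ q"
      unfolding U_def using \<open>0 < p\<close> \<open>1 \<le> C\<close>
      by (intro mult_mono P_le i power_increasing cyclic_dist_le j) auto
    then show ?thesis
      by (simp add: x_def mult_ac)
  qed
  have U_le: "U t \<le> (\<eta>\<^sup>2) ^ t * U 0" for t
  proof (induction t)
    case (Suc t)
    have "U (Suc t) \<le> \<eta>\<^sup>2 * U t"
      by (rule U_Suc)
    also have "\<dots> \<le> \<eta>\<^sup>2 * ((\<eta>\<^sup>2) ^ t * U 0)"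
      by (intro mult_left_mono Suc) simp
    finally show ?case
      by (simp add: mult.assoc)
  qed simp
  \<comment> \<open>The weight \<open>C ^ d\<close> is at least 1 because
    \<open>1 \<le> C\<close>.\<close>
  have "(norm (x t))\<^sup>2 * 1 \<le> U t"
    unfolding U_def using \<open>1 \<le> C\<close> order_trans[OF zero_le_power2 P_ge[OF i]]
    by (intro mult_mono P_ge i) auto
  also have "\<dots> \<le> (\<eta>\<^sup>2) ^ t * (p * C ^ q * (norm x0)\<^sup>2)"
    by (rule order_trans[OF U_le mult_left_mono[OF U_0]]) simp
  also have "\<dots> = (sqrt (p * C ^ q) * \<eta> ^ t * norm x0)\<^sup>2"
    using \<open>0 < p\<close> \<open>1 \<le> C\<close>
    by (simp add: power_mult_distrib real_sqrt_mult[symmetric] power_even_eq[symmetric]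
        power_mult)
  finally show ?thesis
    unfolding x_def[symmetric] mult_1_right
    by (rule power2_le_imp_le) (use \<open>0 < p\<close> \<open>1 \<le> C\<close> \<open>0 \<le> \<eta>\<close> in simp)
qed

text \<open>Each updated controller state consists of a quadratic expression in the plant state and
  an index at most \<open>q\<close>.\<close>

lemma bounded_ctrl_traj:
  fixes P :: "nat \<Rightarrow> real^'n^'n" and K :: "nat \<Rightarrow> real^'n^'m"
  assumes q: "1 \<le> q"
    and P_ge: "\<And>i x. i \<in> {1..q} \<Longrightarrow> (norm x)\<^sup>2 \<le> x \<bullet> (P i *v x)"
    and P_le: "\<And>i x. i \<in> {1..q} \<Longrightarrow> x \<bullet> (P i *v x) \<le> p * (norm x)\<^sup>2"
    and R: "\<And>t. norm (state_traj A B (switch_update \<alpha> q P) (switch_input q P K) x0 z0 t) \<le> R"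
  shows "bounded (range (ctrl_traj A B (switch_update \<alpha> q P) (switch_input q P K) x0 z0))"
proof -
  define x where "x = state_traj A B (switch_update \<alpha> q P) (switch_input q P K) x0 z0"
  define z where "z = ctrl_traj A B (switch_update \<alpha> q P) (switch_input q P K) x0 z0"
  have z_Suc: "norm (z (Suc t)) \<le> \<alpha>\<^sup>2 * (\<bar>p\<bar> * R\<^sup>2) + R\<^sup>2 + real q" for t
  proof -
    define i where "i = switch_index q P (x t) (z t)"
    have i: "i \<in> {1..q}"
      unfolding i_def by (rule switch_index_mem[OF q])
    have xR: "(norm (x t))\<^sup>2 \<le> R\<^sup>2"
      unfolding x_def by (intro power_mono R) simp
    have V_ge: "0 \<le> x t \<bullet> (P i *v x t)"
      by (rule order_trans[OF zero_le_power2 P_ge[OF i]])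
    have "x t \<bullet> (P i *v x t) \<le> p * (norm (x t))\<^sup>2"
      by (rule P_le[OF i])
    also have "\<dots> \<le> \<bar>p\<bar> * R\<^sup>2"
      by (intro mult_mono xR) auto
    finally have V_le: "\<alpha>\<^sup>2 * (x t \<bullet> (P i *v x t)) \<le> \<alpha>\<^sup>2 * (\<bar>p\<bar> * R\<^sup>2)"
      by (rule mult_left_mono) simp
    have aV: "0 \<le> \<alpha>\<^sup>2 * (x t \<bullet> (P i *v x t))"
      using V_ge by simp
    have "z (Suc t) = vector [\<alpha>\<^sup>2 * (x t \<bullet> (P i *v x t)) - (norm (x t))\<^sup>2, real i]"
      by (simp add: z_def x_def i_def ctrl_traj_Suc switch_update_def Let_def)
    then have "norm (z (Suc t)) \<le> \<bar>\<alpha>\<^sup>2 * (x t \<bullet> (P i *v x t)) - (norm (x t))\<^sup>2\<bar> + real i"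
      using norm_le_l1_cart[of "z (Suc t)"] by (simp add: sum_2)
    moreover have "real i \<le> real q"
      using i by simp
    moreover have "0 \<le> (norm (x t))\<^sup>2"
      by simp
    ultimately show ?thesis
      using aV V_le xR by linarith
  qed
  \<comment> \<open>The initial value \<open>z0\<close> is arbitrary and enters through the
    maximum.\<close>
  have "norm (z t) \<le> max (norm z0) (\<alpha>\<^sup>2 * (\<bar>p\<bar> * R\<^sup>2) + R\<^sup>2 + real q)" for t
  proof (cases t)
    case 0
    then show ?thesis by (simp add: z_def)
  next
    case (Suc s)
    then show ?thesis using z_Suc[of s] by (simp add: le_max_iff_disj)
  qed
  then show ?thesis
    unfolding z_def[symmetric] by (auto intro: boundedI)
qed

section \<open>Constants uniform over the compact set of systems\<close>

theorem theorem11: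
  fixes \<alpha> :: real
    and \<Sigma>pk :: "((real^'n^'n) \<times> (real^'m^'n)) set"
    and q :: nat
    and K :: "nat \<Rightarrow> real^'n^'m"
    and P :: "nat \<Rightarrow> real^'n^'n"
  assumes "0 < \<alpha>" and "\<alpha> \<le> 1"
    and "\<Sigma>pk \<subseteq> Sigma_stab \<alpha>" and "compact \<Sigma>pk"
    and "1 \<le> q"
    and "\<And>i. i \<in> {1..q} \<Longrightarrow> transpose (P i) = P i"
    and "\<And>i. i \<in> {1..q} \<Longrightarrow> loewner_le (mat 1) (P i)"
    and "\<And>A B. (A, B) \<in> \<Sigma>pk \<Longrightarrow>
           \<exists>i\<in>{1..q}. loewner_le (mat 1)
             (\<alpha>\<^sup>2 *\<^sub>R P i - transpose (A + B ** K i) ** P i ** (A + B ** K i))"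
  shows "(\<forall>x0 z0. \<forall>(A, B)\<in>\<Sigma>pk.
            bounded (range (ctrl_traj A B (switch_update \<alpha> q P) (switch_input q P K) x0 z0)))
       \<and> (\<exists>c \<eta>. 1 \<le> c \<and> 0 \<le> \<eta> \<and> \<eta> < \<alpha> \<and>
            (\<forall>(A, B)\<in>\<Sigma>pk. \<forall>x0 z0 t.
               norm (state_traj A B (switch_update \<alpha> q P) (switch_input q P K) x0 z0 t)
                 \<le> c * \<eta> ^ t * norm x0))"
proof -
  have P_ge: "(norm x)\<^sup>2 \<le> x \<bullet> (P i *v x)" if "i \<in> {1..q}" for i x
    using loewner_leD[OF assms(7)[OF that], of x] by (simp add: power2_norm_eq_inner)
  \<comment> \<open>The summand \<open>2 / \<alpha>\<^sup>2\<close> makes \<open>\<eta>\<close> positive.\<close>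
  define p where "p = 2 / \<alpha>\<^sup>2 + (\<Sum>i\<in>{1..q}. norm (P i))"
  have p: "2 / \<alpha>\<^sup>2 \<le> p"
    unfolding p_def by (simp add: sum_nonneg)
  have "\<alpha>\<^sup>2 \<le> 1"
    using assms(1,2) by (simp add: power_le_one)
  then have "2 \<le> 2 / \<alpha>\<^sup>2"
    using assms(1) by (simp add: le_divide_eq)
  with p have "1 \<le> p" "0 < p"
    by linarith+
  have P_le: "x \<bullet> (P i *v x) \<le> p * (norm x)\<^sup>2" if "i \<in> {1..q}" for i x
  proof -
    have "norm (P i) \<le> (\<Sum>i\<in>{1..q}. norm (P i))"
      using that by (intro member_le_sum) auto
    then have "norm (P i) \<le> p"
      using \<open>2 \<le> 2 / \<alpha>\<^sup>2\<close> unfolding p_def by linarith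
    then show ?thesis
      by (meson quadratic_form_le mult_right_mono order_trans zero_le_power2)
  qed
  \<comment> \<open>Compactness gives one bound for all systems; hence \<open>M\<close>,
    \<open>C\<close> and \<open>c\<close> below do not depend on the pair.\<close>
  obtain b where b: "\<And>A B. (A, B) \<in> \<Sigma>pk \<Longrightarrow> norm (A, B) \<le> b"
    using compact_imp_bounded[OF assms(4)] unfolding bounded_iff by blast
  define k where "k = (\<Sum>i\<in>{1..q}. norm (K i))"
  define M where "M = b + b * k"
  have M: "norm ((A + B ** K i) *v x) \<le> M * norm x"
    if "(A, B) \<in> \<Sigma>pk" "i \<in> {1..q}" for A B i x
  proof -
    have AB: "norm A \<le> b" "norm B \<le> b"
      using b[OF that(1)] norm_fst_le norm_snd_le order_trans by blast+
    \<comment> \<open>For empty \<open>\<Sigma>pk\<close> the bound \<open>b\<close> could be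
      negative, so its sign is read off from the given pair.\<close>
    then have "0 \<le> b"
      using norm_ge_zero order_trans by blast
    have k: "norm (K i) \<le> k"
      unfolding k_def using that(2) by (intro member_le_sum) auto
    have "norm ((A + B ** K i) *v x) \<le> norm (A *v x) + norm (B *v (K i *v x))"
      by (simp add: matrix_vector_mult_add_rdistrib matrix_vector_mul_assoc[symmetric]
          norm_triangle_ineq)
    also have "\<dots> \<le> norm A * norm x + norm B * (norm (K i) * norm x)"
      by (intro add_mono norm_matrix_vector_mult_le
          order_trans[OF norm_matrix_vector_mult_le mult_left_mono]) auto
    also have "\<dots> \<le> b * norm x + b * (k * norm x)"
      using AB k \<open>0 \<le> b\<close> by (intro add_mono mult_mono mult_right_mono) auto
    finally show ?thesis
      by (simp add: M_def algebra_simps)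
  qed
  define \<eta> where "\<eta> = sqrt (\<alpha>\<^sup>2 - 1 / p)"
  have "1 / p < \<alpha>\<^sup>2"
  proof -
    have "2 \<le> p * \<alpha>\<^sup>2"
      using p assms(1) by (simp add: divide_le_eq)
    then show ?thesis
      using \<open>0 < p\<close> by (simp add: divide_less_eq mult.commute)
  qed
  then have \<eta>: "\<eta>\<^sup>2 = \<alpha>\<^sup>2 - 1 / p" "0 < \<eta>"
    by (simp_all add: \<eta>_def)
  have "\<eta> < \<alpha>"
    using \<eta>(1) \<open>0 < p\<close> assms(1) by (auto intro: power2_less_imp_less)
  \<comment> \<open>The quotient pays for the growth at a switch, and the summand 1 ensures
    \<open>1 \<le> C\<close>.\<close>
  define C where "C = 1 + p * M\<^sup>2 / \<eta>\<^sup>2"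
  have "1 \<le> C" and C: "p * M\<^sup>2 \<le> \<eta>\<^sup>2 * C"
    using \<open>0 < p\<close> \<open>0 < \<eta>\<close> by (simp_all add: C_def distrib_left)
  define c where "c = sqrt (p * C ^ q)"
  have "1 * 1 \<le> p * C ^ q"
    using \<open>1 \<le> p\<close> \<open>1 \<le> C\<close> by (intro mult_mono) auto
  then have "1 \<le> c"
    by (simp add: c_def)
  have decay: "norm (state_traj A B (switch_update \<alpha> q P) (switch_input q P K) x0 z0 t)
      \<le> c * \<eta> ^ t * norm x0" if AB: "(A, B) \<in> \<Sigma>pk" for A B x0 z0 t
  proof -
    obtain j where j: "j \<in> {1..q}"
      "loewner_le (mat 1) (\<alpha>\<^sup>2 *\<^sub>R P j - transpose (A + B ** K j) ** P j ** (A + B ** K j))"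
      using assms(8)[OF AB] by blast
    show ?thesis
      unfolding c_def
      by (rule switched_decay[where A = A and B = B and K = K and P = P,
            OF assms(5) \<open>0 < p\<close> \<open>1 \<le> C\<close> less_imp_le[OF \<eta>(2)] \<eta>(1) P_ge P_le M[OF AB] C j])
  qed
  have "bounded (range (ctrl_traj A B (switch_update \<alpha> q P) (switch_input q P K) x0 z0))"
    if AB: "(A, B) \<in> \<Sigma>pk" for A B x0 z0
  proof (rule bounded_ctrl_traj[where P = P, OF assms(5) P_ge P_le])
    fix t
    \<comment> \<open>Since \<open>\<eta> < \<alpha> \<le> 1\<close>, the decay bound also gives the
      time-independent bound \<open>c * norm x0\<close>.\<close>
    have "c * \<eta> ^ t * norm x0 \<le> c * 1 * norm x0"
      using \<open>1 \<le> c\<close> \<open>0 < \<eta>\<close> \<open>\<eta> < \<alpha>\<close> assms(2)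
      by (intro mult_right_mono mult_left_mono power_le_one) auto
    with decay[OF AB, of x0 z0 t]
    show "norm (state_traj A B (switch_update \<alpha> q P) (switch_input q P K) x0 z0 t) \<le> c * norm x0"
      by simp
  qed
  then show ?thesis
    using decay \<open>1 \<le> c\<close> \<open>0 < \<eta>\<close> \<open>\<eta> < \<alpha>\<close> by (intro conjI exI[of _ c] exI[of _ \<eta>]) auto
qed

end
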